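(* Let $\delta_k>0$ with $\delta_k\to0$ and let $g_k\in H_2$ with $\|g_k-g\|\le\delta_k$. Let $\Gamma$ be Morozov's discrepancy principle with parameter $\rho>1$ and assume that $\lim_{k\to\infty}\Gamma(\delta_k,g_k)=\infty$. Then $$\lim_{k\to\infty}\delta_k^2\,t_{\Gamma(\delta_k,g_k)}=0\quad\text{and}\quad\lim_{k\to\infty}t_{\Gamma(\delta_k,g_k)}=+\infty .$$
   Context: $H_1,H_2$ are separable (real) Hilbert spaces, $K:H_1\to H_2$ is linear and bounded, and $J:H_1\to\mathbb{R}\cup\{\infty\}$ is convex, lower semicontinuous and proper with domain $D(J)=\{u: J(u)<\infty\}$. It is assumed that for every $c\in\mathbb{R}$ every sequence in $\{u\in H_1:\|Ku\|^2+J(u)\le c\}$ has a weakly convergent subsequence in $H_1$. The element $g\in H_2$ is attainable, i.e. $Ku=g$ for some $u\in D(J)$. Augmented Lagrangian method: $\{\tau_n\}_{n\ge1}$ is a fixed sequence of positive numbers, $t_n:=\sum_{k=1}^n\tau_k$, with $t_n\to+\infty$ and $\bar\tau:=\sup_k\tau_k<\infty$. Given data $g^\delta$ and a fixed starting element $p_0^\delta=p_0\in H_2$, for $n=1,2,\dots$ $$u_n^\delta\in\operatorname{argmin}_{u\in H_1}\Big(\tfrac{\tau_n}{2}\|Ku-g^\delta\|^2+J(u)-\langle p_{n-1}^\delta,Ku-g^\delta\rangle\Big),\qquad p_n^\delta=p_{n-1}^\delta+\tau_n(g^\delta-Ku_n^\delta).$$ Morozov's discrepancy principle with $\rho>1$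 is the stopping rule $\Gamma(\delta,g^\delta):=\min\{n\in\mathbb{N}, n\ge1:\ \|Ku_n^\delta-g^\delta\|<\rho\delta\}$ (this minimum exists whenever $\|g^\delta-g\|\le\delta$). Here $\Gamma(\delta_k,g_k)$ is formed with $\delta=\delta_k$ and $g^\delta=g_k$. *)

theory Defs
  imports "HOL-Analysis.Analysis"
begin

definition proper_fun :: "('a \<Rightarrow> ereal) \<Rightarrow> bool" where
  "proper_fun J \<longleftrightarrow> (\<forall>u. J u \<noteq> -\<infinity>) \<and> (\<exists>u. J u < \<infinity>)"

text \<open>The weights lie in the closed unit interval. At the end points this uses \<open>0 * \<infinity> = 0\<close>
  in \<^typ>\<open>ereal\<close>, so the inequality is then trivially true. No indeterminate sum
  \<open>\<infinity> + (-\<infinity>)\<close> occurs for functions that avoid \<open>-\<infinity>\<close>.\<close>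
definition convex_ereal :: "('a::real_vector \<Rightarrow> ereal) \<Rightarrow> bool" where
  "convex_ereal J \<longleftrightarrow>
     (\<forall>u v. \<forall>s\<in>{0..1::real}.
        J ((1 - s) *\<^sub>R u + s *\<^sub>R v) \<le> ereal (1 - s) * J u + ereal s * J v)"

definition lower_semicontinuous :: "('a::topological_space \<Rightarrow> ereal) \<Rightarrow> bool" where
  "lower_semicontinuous J \<longleftrightarrow> (\<forall>u. J u \<le> Liminf (nhds u) J)"

definition weakly_converges :: "(nat \<Rightarrow> 'a::real_normed_vector) \<Rightarrow> 'a \<Rightarrow> bool" where
  "weakly_converges x l \<longleftrightarrow>
     (\<forall>\<phi>::'a \<Rightarrow> real. bounded_linear \<phi> \<longrightarrow> (\<lambda>n. \<phi> (x n)) \<longlonglongrightarrow> \<phi> l)"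

text \<open>\<open>tsum \<tau> n\<close> is the partial sum \<open>t\<^sub>n\<close>, with step sizes indexed from 1.\<close>
definition tsum :: "(nat \<Rightarrow> real) \<Rightarrow> nat \<Rightarrow> real" where
  "tsum \<tau> n = (\<Sum>k=1..n. \<tau> k)"

definition alm_objective ::
    "('a::real_inner \<Rightarrow> 'b::real_inner) \<Rightarrow> ('a \<Rightarrow> ereal) \<Rightarrow> 'b \<Rightarrow> real \<Rightarrow> 'b \<Rightarrow> 'a \<Rightarrow> ereal" where
  "alm_objective K J gd \<tau> p u =
     ereal (\<tau> / 2 * (norm (K u - gd))\<^sup>2) + J u - ereal (p \<bullet> (K u - gd))"

text \<open>Minimizers need not be unique, so the method is a predicate on pairs of sequences of
  iterates rather than a function of the data. The value \<open>u 0\<close> is unconstrained.\<close>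
definition alm_iterates ::
    "('a::real_inner \<Rightarrow> 'b::real_inner) \<Rightarrow> ('a \<Rightarrow> ereal) \<Rightarrow> (nat \<Rightarrow> real) \<Rightarrow> 'b \<Rightarrow> 'b \<Rightarrow>
      (nat \<Rightarrow> 'a) \<Rightarrow> (nat \<Rightarrow> 'b) \<Rightarrow> bool" where
  "alm_iterates K J \<tau> p0 gd u p \<longleftrightarrow>
     p 0 = p0 \<and>
     (\<forall>n\<ge>1. is_arg_min (alm_objective K J gd (\<tau> n) (p (n - 1))) (\<lambda>_. True) (u n) \<and>
            p n = p (n - 1) + \<tau> n *\<^sub>R (gd - K (u n)))"

text \<open>Morozov's discrepancy principle for the primal iterates \<open>u\<close>. If no index satisfied the
  bound, \<open>LEAST\<close> would be unspecified; for noise level at most \<open>\<delta>\<close> and \<open>\<rho> > 1\<close> the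
  minimum exists.\<close>
definition morozov ::
    "('a \<Rightarrow> 'b::real_normed_vector) \<Rightarrow> real \<Rightarrow> (nat \<Rightarrow> 'a) \<Rightarrow> real \<Rightarrow> 'b \<Rightarrow> nat" where
  "morozov K \<rho> u \<delta> gd = (LEAST n. n \<ge> 1 \<and> norm (K (u n) - gd) < \<rho> * \<delta>)"

end

theory Submission
  imports Defs
begin

text \<open>In the dual variable the method is a proximal point iteration for
  \<open>q \<mapsto> J\<^sup>*(K\<^sup>* q) - \<langle>q, g\<^sup>\<delta>\<rangle>\<close>. Let \<open>N = \<Gamma> - 1\<close>, so that all residuals up to
  step \<open>N\<close> are at least \<open>\<rho>\<delta>\<close>. The energy estimate for proximal point iterations then shows, for
  every \<open>q\<close>, that \<open>(\<rho>\<^sup>2 - 1) \<delta>\<^sup>2 t\<^sub>N\<^sup>2 \<le> \<parallel>q - p\<^sub>0\<parallel>\<^sup>2 + 2 t\<^sub>N \<epsilon>(q)\<close>, where \<open>\<epsilon>(q)\<close> is the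
  primal-dual gap for the exact data. Compactness of the sublevel sets makes the optimal gap zero,
  so \<open>\<epsilon>(q)\<close> can be chosen arbitrarily small before dividing by \<open>t\<^sub>N\<close>.\<close>

section \<open>Projection and separation in a Hilbert space\<close>

text \<open>Let \<open>s\<close> tend to zero from the right. This turns comparison along a segment
  into a first-order condition, for the projection and again for the augmented Lagrangian
  step.\<close>

lemma nonneg_if_perturbed_nonneg:
  fixes a b :: real
  assumes "\<And>s. 0 < s \<Longrightarrow> s \<le> 1 \<Longrightarrow> 0 \<le> a + s * b"
  shows "0 \<le> a"
proof (rule tendsto_lowerbound)
  show "((\<lambda>s. a + s * b) \<longlongrightarrow> a) (at_right 0)"
    by (auto intro!: tendsto_eq_intros)
  show "\<forall>\<^sub>F s in at_right 0. 0 \<le> a + s * b"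
    using eventually_at_right_real[OF zero_less_one]
    by eventually_elim (auto intro: assms)
qed auto

text \<open>By the parallelogram identity a minimizing sequence for the squared distance to
  \<open>z\<close> is Cauchy, so completeness does the work of compactness.\<close>

lemma closest_point_in_closed_convex:
  fixes S :: "'a::{real_inner, complete_space} set"
  assumes "convex S" "closed S" "S \<noteq> {}"
  obtains y where "y \<in> S" "\<And>x. x \<in> S \<Longrightarrow> norm (y - z) \<le> norm (x - z)"
proof -
  define D where "D = (INF x\<in>S. (norm (x - z))\<^sup>2)"
  have bdd: "bdd_below ((\<lambda>x. (norm (x - z))\<^sup>2) ` S)"
    by (rule bdd_belowI2[of _ 0]) simp
  have D: "D \<le> (norm (x - z))\<^sup>2" if "x \<in> S" for x
    unfolding D_def by (rule cINF_lower[OF bdd that])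
  have "\<exists>x\<in>S. (norm (x - z))\<^sup>2 < D + 1 / Suc n" for n
    using cINF_less_iff[OF assms(3) bdd, of "D + 1 / Suc n"] by (simp add: D_def)
  then obtain y where y: "y n \<in> S" "(norm (y n - z))\<^sup>2 < D + 1 / Suc n" for n
    by metis
  \<comment> \<open>The midpoint lies in \<open>S\<close>, so its squared distance to
    \<open>z\<close> is at least \<open>D\<close>; what remains are the excesses of
    \<open>y m\<close> and \<open>y n\<close> over \<open>D\<close>.\<close>
  have le: "(norm (y m - y n))\<^sup>2 \<le> 2 / Suc m + 2 / Suc n" for m n
  proof -
    have "(1/2) *\<^sub>R y m + (1/2) *\<^sub>R y n \<in> S"
      by (rule convexD[OF assms(1)]) (use y in auto)
    from D[OF this] have "D \<le> (norm ((1/2) *\<^sub>R y m + (1/2) *\<^sub>R y n - z))\<^sup>2" .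
    moreover have "(norm (y m - y n))\<^sup>2 = 2 * (norm (y m - z))\<^sup>2 + 2 * (norm (y n - z))\<^sup>2
        - 4 * (norm ((1/2) *\<^sub>R y m + (1/2) *\<^sub>R y n - z))\<^sup>2"
      by (simp add: power2_norm_eq_inner inner_simps inner_commute algebra_simps)
    ultimately show ?thesis
      using y(2)[of m] y(2)[of n] by linarith
  qed
  have "Cauchy y"
  proof (rule metric_CauchyI)
    fix e :: real assume e: "0 < e"
    then have "0 < e\<^sup>2 / 4" by simp
    from reals_Archimedean[OF this] obtain M where M: "inverse (real (Suc M)) < e\<^sup>2 / 4"
      by blast
    have "dist (y m) (y n) < e" if "m \<ge> M" "n \<ge> M" for m n
    proof -
      have "1 / real (Suc m) \<le> 1 / Suc M" "1 / real (Suc n) \<le> 1 / Suc M"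
        using that by (auto intro!: divide_left_mono)
      then have "(norm (y m - y n))\<^sup>2 < e\<^sup>2"
        using le[of m n] M by (simp add: inverse_eq_divide)
      then show ?thesis
        using e by (simp add: dist_norm power_less_imp_less_base)
    qed
    then show "\<exists>M. \<forall>m\<ge>M. \<forall>n\<ge>M. dist (y m) (y n) < e" by blast
  qed
  then obtain l where l: "y \<longlonglongrightarrow> l"
    using Cauchy_convergent convergent_def by blast
  have "l \<in> S"
    using closed_sequentially[OF assms(2) _ l] y(1) by blast
  have "(norm (l - z))\<^sup>2 \<le> D + 0"
  proof (rule LIMSEQ_le)
    show "(\<lambda>n. (norm (y n - z))\<^sup>2) \<longlonglongrightarrow> (norm (l - z))\<^sup>2"
      by (intro tendsto_intros l)
    show "(\<lambda>n. D + 1 / Suc n) \<longlonglongrightarrow> D + 0"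
      by (intro tendsto_intros LIMSEQ_Suc lim_1_over_n)
  qed (use y(2) in \<open>auto intro: less_imp_le\<close>)
  then have "(norm (l - z))\<^sup>2 \<le> (norm (x - z))\<^sup>2" if "x \<in> S" for x
    using D[OF that] by linarith
  then have "norm (l - z) \<le> norm (x - z)" if "x \<in> S" for x
    using that by (blast intro: power2_le_imp_le norm_ge_zero)
  with \<open>l \<in> S\<close> that show ?thesis by blast
qed

text \<open>Take \<open>w = y - z\<close> with \<open>y\<close> the point of \<open>S\<close>
  nearest to \<open>z\<close>. The variational inequality
  \<open>0 \<le> (y - z) \<bullet> (x - y)\<close> gives the margin
  \<open>(norm w)\<^sup>2\<close>.\<close>

lemma separating_vector_closed_convex:
  fixes S :: "'a::{real_inner, complete_space} set"
  assumes "convex S" "closed S" "S \<noteq> {}" "z \<notin> S"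
  obtains w where "w \<noteq> 0" "\<And>x. x \<in> S \<Longrightarrow> (norm w)\<^sup>2 \<le> w \<bullet> (x - z)"
proof -
  obtain y where y: "y \<in> S" "\<And>x. x \<in> S \<Longrightarrow> norm (y - z) \<le> norm (x - z)"
    using closest_point_in_closed_convex[OF assms(1-3), of z] by blast
  have "(norm (y - z))\<^sup>2 \<le> (y - z) \<bullet> (x - z)" if "x \<in> S" for x
  proof -
    have "0 \<le> 2 * ((y - z) \<bullet> (x - y)) + s * (norm (x - y))\<^sup>2" if s: "0 < s" "s \<le> 1" for s
    proof -
      have "(1 - s) *\<^sub>R y + s *\<^sub>R x \<in> S"
        using s y(1) \<open>x \<in> S\<close> by (auto intro!: convexD[OF assms(1)])
      then have "(norm (y - z))\<^sup>2 \<le> (norm ((1 - s) *\<^sub>R y + s *\<^sub>R x - z))\<^sup>2"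
        using y(2) by (simp add: power_mono)
      also have "(1 - s) *\<^sub>R y + s *\<^sub>R x - z = (y - z) + s *\<^sub>R (x - y)"
        by (simp add: algebra_simps)
      also have "(norm ((y - z) + s *\<^sub>R (x - y)))\<^sup>2 =
          (norm (y - z))\<^sup>2 + s * (2 * ((y - z) \<bullet> (x - y)) + s * (norm (x - y))\<^sup>2)"
        by (simp only: power2_norm_eq_inner inner_add_left inner_add_right inner_scaleR_left
            inner_scaleR_right inner_commute[of "x - y" "y - z"]) (simp add: algebra_simps)
      finally show ?thesis
        using s by (simp add: zero_le_mult_iff)
    qed
    then have "0 \<le> 2 * ((y - z) \<bullet> (x - y))"
      by (rule nonneg_if_perturbed_nonneg)
    moreover have "(y - z) \<bullet> (x - z) = (y - z) \<bullet> (x - y) + (norm (y - z))\<^sup>2"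
      by (simp add: power2_norm_eq_inner inner_simps)
    ultimately show ?thesis by simp
  qed
  moreover have "y - z \<noteq> 0" using y(1) assms(4) by auto
  ultimately show ?thesis using that by blast
qed

section \<open>Sublevel sets and weak limits\<close>

lemma closed_sublevel:
  assumes "lower_semicontinuous J"
  shows "closed {x. J x \<le> c}"
proof -
  have "\<exists>T. open T \<and> x \<in> T \<and> T \<subseteq> {x. c < J x}" if "c < J x" for x
  proof -
    have "c < Liminf (nhds x) J"
      using assms that unfolding lower_semicontinuous_def by (metis less_le_trans)
    then have "\<forall>\<^sub>F y in nhds x. c < J y"
      by (rule less_LiminfD)
    then show ?thesis
      by (auto simp: eventually_nhds)
  qed
  then have "open {x. c < J x}"
    by (subst open_subopen) auto
  moreover have "- {x. J x \<le> c} = {x. c < J x}" by auto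
  ultimately show ?thesis by (simp add: closed_def)
qed

lemma convex_ereal_le:
  assumes "convex_ereal J" "J x \<le> ereal a" "J y \<le> ereal b" "0 \<le> s" "s \<le> 1"
  shows "J ((1 - s) *\<^sub>R x + s *\<^sub>R y) \<le> ereal ((1 - s) * a + s * b)"
proof -
  have "J ((1 - s) *\<^sub>R x + s *\<^sub>R y) \<le> ereal (1 - s) * J x + ereal s * J y"
    using assms unfolding convex_ereal_def by auto
  also have "\<dots> \<le> ereal (1 - s) * ereal a + ereal s * ereal b"
    using assms by (intro add_mono ereal_mult_left_mono) auto
  finally show ?thesis by simp
qed

lemma convex_sublevel:
  assumes "convex_ereal J"
  shows "convex {x. J x \<le> ereal c}"
  unfolding convex_alt using convex_ereal_le[OF assms, of _ c _ c] by (auto simp: algebra_simps)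

text \<open>A weak limit outside \<open>S\<close> would be cut off by a functional whose values on
  \<open>S\<close> exceed the value at \<open>l\<close> by a fixed positive amount.\<close>

lemma weak_limit_in_closed_convex:
  fixes S :: "'a::{real_inner, complete_space} set"
  assumes "convex S" "closed S" "weakly_converges x l" "\<forall>\<^sub>F n in sequentially. x n \<in> S"
  shows "l \<in> S"
proof (rule ccontr)
  assume "l \<notin> S"
  have "S \<noteq> {}" using assms(4) by (auto simp: eventually_sequentially)
  obtain w where w: "w \<noteq> 0" "\<And>x. x \<in> S \<Longrightarrow> (norm w)\<^sup>2 \<le> w \<bullet> (x - l)"
    using separating_vector_closed_convex[OF assms(1,2) \<open>S \<noteq> {}\<close> \<open>l \<notin> S\<close>] by blast
  have "(\<lambda>n. w \<bullet> x n) \<longlonglongrightarrow> w \<bullet> l"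
    using assms(3) bounded_linear_inner_right unfolding weakly_converges_def by blast
  moreover have "\<forall>\<^sub>F n in sequentially. (norm w)\<^sup>2 + w \<bullet> l \<le> w \<bullet> x n"
    using assms(4) by eventually_elim (use w(2) in \<open>fastforce simp: inner_diff_right\<close>)
  ultimately have "(norm w)\<^sup>2 + w \<bullet> l \<le> w \<bullet> l"
    by (intro tendsto_lowerbound) auto
  then show False using w(1) by simp
qed

text \<open>Testing with the functional \<open>x \<mapsto> (K l - y) \<bullet> K x\<close> forces
  \<open>K l - y\<close> to be orthogonal to itself.\<close>

lemma weak_limit_bounded_linear_image:
  fixes K :: "'a::real_normed_vector \<Rightarrow> 'b::real_inner"
  assumes "bounded_linear K" "weakly_converges x l" "(\<lambda>n. K (x n)) \<longlonglongrightarrow> y"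
  shows "K l = y"
proof -
  have "(\<lambda>n. (K l - y) \<bullet> K (x n)) \<longlonglongrightarrow> (K l - y) \<bullet> K l"
    using assms(2) bounded_linear_compose[OF bounded_linear_inner_right assms(1)]
    unfolding weakly_converges_def by blast
  moreover have "(\<lambda>n. (K l - y) \<bullet> K (x n)) \<longlonglongrightarrow> (K l - y) \<bullet> y"
    by (intro tendsto_intros assms)
  ultimately have "(K l - y) \<bullet> (K l - y) = 0"
    using LIMSEQ_unique by (fastforce simp: inner_diff_right)
  then show ?thesis by simp
qed

section \<open>Approximate multipliers for the exact data\<close>

text \<open>The multiplier \<open>q\<close> comes from separating \<open>(g, inf - \<epsilon>)\<close> from the closed epigraph of the value function
  \<open>y \<mapsto> inf {J v | K v = y}\<close>.\<close>
lemma approximate_multiplier: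
  fixes K :: "'a::{real_inner, complete_space} \<Rightarrow> 'b::{real_inner, complete_space}"
  assumes K: "bounded_linear K"
    and J: "convex_ereal J" "lower_semicontinuous J" "proper_fun J"
    and compact: "\<And>(c::real) x. (\<And>n::nat. ereal ((norm (K (x n)))\<^sup>2) + J (x n) \<le> ereal c) \<Longrightarrow>
           \<exists>r l. strict_mono r \<and> weakly_converges (x \<circ> r) l"
    and attainable: "\<exists>v. J v < \<infinity> \<and> K v = g"
    and "0 < \<epsilon>"
  obtains v q j where "K v = g" "J v = ereal j"
    "\<And>w. J w \<ge> ereal (j - \<epsilon> + q \<bullet> (K w - g))"
proof -
  interpret K: bounded_linear K by (rule K)
  \<comment> \<open>Convergence bounds \<open>K (x n)\<close>, so the compactness hypothesis yields
    a weak limit, and it lies in each sublevel set that contains a tail. With \<open>c\<close> free,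
    the fact serves both the lower bound on \<open>A\<close> and the exclusion of a point from
    \<open>closure E\<close>.\<close>
  have limit: "\<exists>l. K l = g \<and> (\<forall>c. (\<forall>\<^sub>F n in sequentially. J (x n) \<le> ereal c) \<longrightarrow> J l \<le> ereal c)"
    if x: "(\<lambda>n. K (x n)) \<longlonglongrightarrow> g" "\<And>n. J (x n) \<le> ereal b" for x b
  proof -
    have "Bseq (\<lambda>n. K (x n))"
      using x(1) by (rule convergent_imp_Bseq[OF convergentI])
    then obtain B where B: "\<And>n. norm (K (x n)) \<le> B"
      unfolding Bseq_def by blast
    have "ereal ((norm (K (x n)))\<^sup>2) + J (x n) \<le> ereal (B\<^sup>2) + ereal b" for n
      using B[of n] x(2)[of n] by (intro add_mono) (auto intro: power_mono)
    then obtain r l where r: "strict_mono r" and l: "weakly_converges (x \<circ> r) l"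
      using compact[of x "B\<^sup>2 + b"] by auto
    have "K l = g"
      using weak_limit_bounded_linear_image[OF K l] LIMSEQ_subseq_LIMSEQ[OF x(1) r]
      by (simp add: o_def)
    moreover have "J l \<le> ereal c" if "\<forall>\<^sub>F n in sequentially. J (x n) \<le> ereal c" for c
    proof -
      have "\<forall>\<^sub>F n in sequentially. (x \<circ> r) n \<in> {x. J x \<le> ereal c}"
        using eventually_subseq[OF r that] by simp
      from weak_limit_in_closed_convex[OF convex_sublevel[OF J(1)] closed_sublevel[OF J(2)] l this]
      show ?thesis by simp
    qed
    ultimately show ?thesis by blast
  qed
  have not_MInf: "J w \<noteq> -\<infinity>" for w
    using J(3) by (simp add: proper_fun_def)
  define A where "A = {s. \<exists>v. K v = g \<and> J v = ereal s}"
  have A_ne: "A \<noteq> {}"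
  proof -
    obtain v where v: "J v < \<infinity>" "K v = g" using attainable by blast
    then obtain s where "J v = ereal s" using not_MInf[of v] by (cases "J v") auto
    then show ?thesis using v unfolding A_def by blast
  qed
  \<comment> \<open>Otherwise a sequence in the fibre over \<open>g\<close> with
    \<open>J (x n) \<le> - real n\<close> has a weak limit in every sublevel set, where
    \<open>J\<close> would be \<open>-\<infinity>\<close>.\<close>
  have A_bdd: "bdd_below A"
  proof (rule ccontr)
    assume "\<not> bdd_below A"
    then have "\<exists>s\<in>A. s < - real n" for n
      unfolding bdd_below_def by (meson not_le)
    then have "\<exists>v. K v = g \<and> J v \<le> ereal (- real n)" for n
    proof -
      obtain s where "s \<in> A" "s < - real n"
        using \<open>\<And>n. \<exists>s\<in>A. s < - real n\<close> by blast
      then obtain v where "K v = g" "J v = ereal s" by (auto simp: A_def)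
      with \<open>s < - real n\<close> show ?thesis by (intro exI[of _ v]) simp
    qed
    then obtain x where x: "\<And>n. K (x n) = g" "\<And>n. J (x n) \<le> ereal (- real n)"
      by metis
    have "J (x n) \<le> ereal 0" for n
      using x(2)[of n] by (rule order_trans) simp
    then obtain l where l: "\<And>c. (\<forall>\<^sub>F n in sequentially. J (x n) \<le> ereal c) \<Longrightarrow> J l \<le> ereal c"
      using limit[of x 0] x(1) by auto
    have "J l \<le> ereal c" for c
    proof (rule l)
      show "\<forall>\<^sub>F n in sequentially. J (x n) \<le> ereal c"
        using eventually_ge_at_top[of "nat \<lceil>- c\<rceil>"]
      proof eventually_elim
        case (elim n)
        then have "- real n \<le> c" by linarith
        with x(2)[of n] show ?case by (meson ereal_less_eq(3) order_trans)
      qed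
    qed
    then have "J l = -\<infinity>" by (rule ereal_bot)
    then show False using not_MInf by blast
  qed
  define m where "m = Inf A"
  have m: "m \<le> s" if "s \<in> A" for s
    unfolding m_def using that A_bdd by (rule cInf_lower)
  \<comment> \<open>Half of \<open>\<epsilon>\<close> is spent on near-attainment of
    \<open>m\<close>, the other half on the height of the point
    \<open>(g, m - \<epsilon> / 2)\<close> to be separated.\<close>
  obtain j where j: "j \<in> A" "j < m + \<epsilon> / 2"
    using cInf_lessD[OF A_ne, of "m + \<epsilon> / 2"] \<open>0 < \<epsilon>\<close> by (auto simp: m_def)
  then obtain v where v: "K v = g" "J v = ereal j" by (auto simp: A_def)
  define E where "E = {(K w, s) | w s. J w \<le> ereal s}"
  have "convex E"
    unfolding convex_alt
  proof clarify
    fix a b a' b' and s :: real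
    assume "(a, b) \<in> E" "(a', b') \<in> E" "0 \<le> s" "s \<le> 1"
    moreover from this obtain w w' where "a = K w" "a' = K w'" "J w \<le> ereal b" "J w' \<le> ereal b'"
      by (auto simp: E_def)
    ultimately show "(1 - s) *\<^sub>R (a, b) + s *\<^sub>R (a', b') \<in> E"
      unfolding E_def
      by (auto intro!: exI[of _ "(1 - s) *\<^sub>R w + s *\<^sub>R w'"] convex_ereal_le[OF J(1)]
          simp: K.add K.scaleR)
  qed
  have vE: "(g, j) \<in> closure E"
    using v by (intro closure_subset[THEN subsetD]) (auto simp: E_def)
  \<comment> \<open>An approximating sequence in \<open>E\<close> would have a weak limit in the
    fibre over \<open>g\<close> with \<open>J\<close> at most \<open>m - \<epsilon> / 4\<close>,
    below the infimum.\<close>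
  have "(g, m - \<epsilon> / 2) \<notin> closure E"
  proof
    assume "(g, m - \<epsilon> / 2) \<in> closure E"
    then obtain e where e: "\<And>n. e n \<in> E" "e \<longlonglongrightarrow> (g, m - \<epsilon> / 2)"
      by (auto simp: closure_sequential)
    have "\<exists>w. fst (e n) = K w \<and> J w \<le> ereal (snd (e n))" for n
      using e(1)[of n] by (auto simp: E_def)
    then obtain x where x: "\<And>n. fst (e n) = K (x n)" "\<And>n. J (x n) \<le> ereal (snd (e n))"
      by metis
    have lim: "(\<lambda>n. K (x n)) \<longlonglongrightarrow> g" "(\<lambda>n. snd (e n)) \<longlonglongrightarrow> m - \<epsilon> / 2"
      using tendsto_fst[OF e(2)] tendsto_snd[OF e(2)] x(1) by auto
    have "\<forall>\<^sub>F n in sequentially. snd (e n) < m - \<epsilon> / 4"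
      using \<open>0 < \<epsilon>\<close> by (intro order_tendstoD(2)[OF lim(2)]) auto
    then obtain k where k: "\<And>n. n \<ge> k \<Longrightarrow> snd (e n) < m - \<epsilon> / 4"
      by (auto simp: eventually_sequentially)
    have le: "J (x (n + k)) \<le> ereal (m - \<epsilon> / 4)" for n
      using x(2)[of "n + k"] k[of "n + k"] by (meson ereal_less_eq(3) le_add2 less_imp_le order_trans)
    obtain l where l: "K l = g" "J l \<le> ereal (m - \<epsilon> / 4)"
      using limit[OF LIMSEQ_ignore_initial_segment[OF lim(1)] le] le by auto
    then obtain s where "J l = ereal s"
      using not_MInf[of l] by (cases "J l") auto
    then have "s \<in> A" "s \<le> m - \<epsilon> / 4"
      using l by (auto simp: A_def)
    then show False using m \<open>0 < \<epsilon>\<close> by fastforce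
  qed
  moreover have "closure E \<noteq> {}" using vE by auto
  ultimately obtain ab where ab: "ab \<noteq> 0"
      "\<And>e. e \<in> closure E \<Longrightarrow> (norm ab)\<^sup>2 \<le> ab \<bullet> (e - (g, m - \<epsilon> / 2))"
    by (metis separating_vector_closed_convex[OF convex_closure[OF \<open>convex E\<close>] closed_closure])
  obtain a b where ab_eq: "ab = (a, b)" by (cases ab)
  have pos: "0 < (norm (a, b))\<^sup>2" using ab(1) by (simp add: ab_eq)
  \<comment> \<open>\<open>(g, j)\<close> lies directly above the separated point, so only the last
    component of the normal contributes: the hyperplane is not vertical.\<close>
  have "0 < b * (j - (m - \<epsilon> / 2))"
    using less_le_trans[OF pos ab(2)[OF vE, unfolded ab_eq]] by simp
  moreover have "0 < j - (m - \<epsilon> / 2)"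
    using m[OF j(1)] \<open>0 < \<epsilon>\<close> by linarith
  ultimately have b: "0 < b"
    by (simp add: zero_less_mult_iff)
  \<comment> \<open>The multiplier is the slope \<open>- a / b\<close> of the hyperplane; the height
    is right because \<open>j - \<epsilon> < m - \<epsilon> / 2\<close>.\<close>
  have "J w \<ge> ereal (j - \<epsilon> + (- (1 / b) *\<^sub>R a) \<bullet> (K w - g))" for w
  proof (cases "J w")
    case (real s)
    then have "(K w, s) \<in> closure E"
      by (intro closure_subset[THEN subsetD]) (auto simp: E_def)
    from less_le_trans[OF pos ab(2)[OF this, unfolded ab_eq]]
    have "0 \<le> a \<bullet> (K w - g) + b * (s - (m - \<epsilon> / 2))"
      by simp
    then have "0 \<le> (a \<bullet> (K w - g) + b * (s - (m - \<epsilon> / 2))) / b"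
      using b by simp
    then have "0 \<le> (1 / b) * (a \<bullet> (K w - g)) + (s - (m - \<epsilon> / 2))"
      using b by (simp add: add_divide_distrib)
    then show ?thesis
      using real j(2) by simp
  qed (use not_MInf in auto)
  with v that show ?thesis by blast
qed

section \<open>Optimality in the augmented Lagrangian step\<close>

lemma alm_minimizer_finite:
  assumes "proper_fun J" "is_arg_min (alm_objective K J gd \<tau> p) (\<lambda>_. True) u"
  obtains s where "J u = ereal s"
proof -
  obtain w where w: "J w < \<infinity>" using assms(1) by (auto simp: proper_fun_def)
  have "alm_objective K J gd \<tau> p u \<le> alm_objective K J gd \<tau> p w"
    using assms(2) by (auto simp: is_arg_min_def not_less)
  moreover have "alm_objective K J gd \<tau> p w < \<infinity>"
    using w by (cases "J w") (auto simp: alm_objective_def)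
  ultimately have "J u \<noteq> \<infinity>" by (auto simp: alm_objective_def)
  moreover have "J u \<noteq> -\<infinity>" using assms(1) by (simp add: proper_fun_def)
  ultimately show ?thesis using that by (cases "J u") auto
qed

text \<open>The adjoint of \<open>K\<close> applied to the updated multiplier is a subgradient of
  \<open>J\<close> at \<open>u\<close>. Along the segment from \<open>u\<close> to \<open>v\<close>,
  convexity bounds \<open>J\<close> linearly in \<open>s\<close>, and the penalty adds only order
  \<open>s\<^sup>2\<close> to its linear part.\<close>

lemma alm_optimality:
  fixes K :: "'a::real_inner \<Rightarrow> 'b::real_inner"
  assumes "linear K" "convex_ereal J"
    and min: "is_arg_min (alm_objective K J gd \<tau> p) (\<lambda>_. True) u"
    and "J u = ereal a" "J v = ereal b"
  shows "a + (p + \<tau> *\<^sub>R (gd - K u)) \<bullet> (K v - K u) \<le> b"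
proof -
  define x where "x = K u - gd"
  define h where "h = K v - K u"
  have "0 \<le> (b - a - (p - \<tau> *\<^sub>R x) \<bullet> h) + s * (\<tau> / 2 * (norm h)\<^sup>2)"
    if s: "0 < s" "s \<le> 1" for s
  proof -
    let ?w = "(1 - s) *\<^sub>R u + s *\<^sub>R v"
    have Kw: "K ?w - gd = x + s *\<^sub>R h"
      using assms(1) by (simp add: x_def h_def linear_add linear_diff linear_scale algebra_simps)
    have "alm_objective K J gd \<tau> p u \<le> alm_objective K J gd \<tau> p ?w"
      using min by (auto simp: is_arg_min_def not_less)
    also have "\<dots> \<le> ereal (\<tau> / 2 * (norm (K ?w - gd))\<^sup>2) + ereal ((1 - s) * a + s * b)
        - ereal (p \<bullet> (K ?w - gd))"
      unfolding alm_objective_def using s assms(4,5)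
      by (intro ereal_minus_mono add_mono convex_ereal_le[OF assms(2)]) auto
    finally have "\<tau> / 2 * (norm x)\<^sup>2 + a - p \<bullet> x
        \<le> \<tau> / 2 * (norm (x + s *\<^sub>R h))\<^sup>2 + ((1 - s) * a + s * b) - p \<bullet> (x + s *\<^sub>R h)"
      unfolding Kw using assms(4) by (simp add: alm_objective_def flip: x_def)
    moreover have "(norm (x + s *\<^sub>R h))\<^sup>2 = (norm x)\<^sup>2 + 2 * s * (x \<bullet> h) + s\<^sup>2 * (norm h)\<^sup>2"
      by (simp only: power2_norm_eq_inner inner_add_left inner_add_right inner_scaleR_left
          inner_scaleR_right inner_commute[of h x])
        (simp add: algebra_simps power2_eq_square)
    ultimately have "0 \<le> s * ((b - a - (p - \<tau> *\<^sub>R x) \<bullet> h) + s * (\<tau> / 2 * (norm h)\<^sup>2))"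
      by (simp add: inner_add_right inner_diff_left power2_eq_square algebra_simps
          add_divide_distrib)
    then show ?thesis using s by (simp add: zero_le_mult_iff)
  qed
  then have "0 \<le> b - a - (p - \<tau> *\<^sub>R x) \<bullet> h"
    by (rule nonneg_if_perturbed_nonneg)
  moreover have "p + \<tau> *\<^sub>R (gd - K u) = p - \<tau> *\<^sub>R x"
    by (simp add: x_def algebra_simps)
  ultimately show ?thesis by (simp add: h_def)
qed

section \<open>Energy estimate and residual bound\<close>

lemma tsum_0 [simp]: "tsum \<tau> 0 = 0"
  by (simp add: tsum_def)

lemma tsum_Suc [simp]: "tsum \<tau> (Suc n) = tsum \<tau> n + \<tau> (Suc n)"
  by (simp add: tsum_def)

lemma tsum_nonneg: "(\<And>n. n \<ge> 1 \<Longrightarrow> \<tau> n > 0) \<Longrightarrow> 0 \<le> tsum \<tau> n"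
  unfolding tsum_def by (rule sum_nonneg) (simp add: less_imp_le)

text \<open>Here \<open>D n\<close> plays the role of the dual functional at \<open>p n\<close>, \<open>-r n\<close> of a subgradient there,
  and \<open>d\<close> of its value at \<open>q\<close>.\<close>
lemma proximal_point_energy:
  fixes p r :: "nat \<Rightarrow> 'b::real_inner" and D \<tau> :: "nat \<Rightarrow> real"
  assumes step: "\<And>n. p (Suc n) = p n + \<tau> (Suc n) *\<^sub>R r (Suc n)"
    and pos: "\<And>n. n \<ge> 1 \<Longrightarrow> \<tau> n > 0"
    and descent: "\<And>n. n \<ge> 1 \<Longrightarrow> D (Suc n) + \<tau> (Suc n) * (norm (r (Suc n)))\<^sup>2 \<le> D n"
    and subgrad: "\<And>n. n \<ge> 1 \<Longrightarrow> D n - (q - p n) \<bullet> r n \<le> d"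
    and "0 \<le> c"
    and "\<And>i. 1 \<le> i \<Longrightarrow> i \<le> n \<Longrightarrow> c \<le> norm (r i)"
  shows "2 * tsum \<tau> n * (D n - d) + (norm (q - p n))\<^sup>2 + (tsum \<tau> n)\<^sup>2 * c\<^sup>2 \<le> (norm (q - p 0))\<^sup>2"
  using assms(6)
proof (induction n)
  case (Suc n)
  let ?t = "tsum \<tau> n" and ?s = "\<tau> (Suc n)" and ?r = "r (Suc n)"
  have t: "0 \<le> ?t" by (rule tsum_nonneg[OF pos])
  have s: "0 < ?s" by (rule pos) simp
  have c: "c\<^sup>2 \<le> (norm ?r)\<^sup>2" using Suc.prems[of "Suc n"] \<open>0 \<le> c\<close> by (simp add: power_mono)
  have IH: "2 * ?t * (D n - d) + (norm (q - p n))\<^sup>2 + ?t\<^sup>2 * c\<^sup>2 \<le> (norm (q - p 0))\<^sup>2"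
    using Suc by simp
  \<comment> \<open>No descent is assumed at \<open>n = 0\<close>, where no minimizer stands behind
    \<open>D 0\<close>; the weight \<open>?t\<close> vanishes there.\<close>
  have "?t * (D (Suc n) + ?s * (norm ?r)\<^sup>2) \<le> ?t * D n"
    using descent[of n] t by (cases "n = 0") (auto intro: mult_left_mono)
  moreover have "?s * (D (Suc n) - d) \<le> ?s * ((q - p (Suc n)) \<bullet> ?r)"
    using subgrad[of "Suc n"] s by (intro mult_left_mono) auto
  moreover have "(norm (q - p n))\<^sup>2 =
      (norm (q - p (Suc n)))\<^sup>2 + 2 * (?s * ((q - p (Suc n)) \<bullet> ?r)) + ?s\<^sup>2 * (norm ?r)\<^sup>2"
  proof -
    have "q - p n = (q - p (Suc n)) + ?s *\<^sub>R ?r" by (simp add: step)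
    then show ?thesis
      by (simp only: power2_norm_eq_inner inner_add_left inner_add_right inner_scaleR_left
          inner_scaleR_right inner_commute[of ?r "q - p (Suc n)"])
        (simp add: algebra_simps power2_eq_square)
  qed
  \<comment> \<open>The factor is the increment of the squared \<open>tsum\<close>:
    \<open>2 * ?t * ?s\<close> comes from the descent, \<open>?s\<^sup>2\<close> from expanding
    \<open>norm (q - p n)\<close>.\<close>
  moreover have "(2 * ?t * ?s + ?s\<^sup>2) * c\<^sup>2 \<le> (2 * ?t * ?s + ?s\<^sup>2) * (norm ?r)\<^sup>2"
    using c t s by (intro mult_left_mono) auto
  ultimately show ?case
    using IH by (simp add: algebra_simps power2_eq_square)
qed simp

text \<open>The iteration sees the noisy data \<open>gd\<close>, while \<open>q\<close> is a
  multiplier for \<open>g\<close>. The mismatch is linear in \<open>gd - g\<close> and is absorbed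
  by completing a square, at the cost of \<open>\<delta>\<^sup>2\<close> in the factor
  \<open>c\<^sup>2 - \<delta>\<^sup>2\<close>.\<close>

lemma alm_residual_bound:
  fixes K :: "'a::real_inner \<Rightarrow> 'b::real_inner"
  assumes K: "linear K"
    and J: "convex_ereal J" "proper_fun J"
    and pos: "\<And>n. n \<ge> 1 \<Longrightarrow> \<tau> n > 0"
    and alm: "alm_iterates K J \<tau> p0 gd u p"
    and v: "K v = g" "J v = ereal j"
    and q: "\<And>w. J w \<ge> ereal (j - \<epsilon> + q \<bullet> (K w - g))"
    and noise: "norm (gd - g) \<le> \<delta>"
    and c: "0 \<le> c" "\<And>i. 1 \<le> i \<Longrightarrow> i \<le> n \<Longrightarrow> c \<le> norm (K (u i) - gd)"
    and n: "1 \<le> n"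
  shows "(c\<^sup>2 - \<delta>\<^sup>2) * (tsum \<tau> n)\<^sup>2 \<le> (norm (q - p0))\<^sup>2 + 2 * \<epsilon> * tsum \<tau> n"
proof -
  let ?t = "tsum \<tau> n"
  define r where "r i = gd - K (u i)" for i
  define a where "a i = real_of_ereal (J (u i))" for i
  \<comment> \<open>For \<open>i \<ge> 1\<close> optimality and Fenchel's equality make this the
    dual functional for the data \<open>gd\<close> at \<open>p i\<close>.\<close>
  define D where "D i = p i \<bullet> (K (u i) - gd) - a i" for i
  have min: "is_arg_min (alm_objective K J gd (\<tau> i) (p (i - 1))) (\<lambda>_. True) (u i)"
    and p: "p i = p (i - 1) + \<tau> i *\<^sub>R r i" if "1 \<le> i" for i
    using alm that by (auto simp: alm_iterates_def r_def)
  have a: "J (u i) = ereal (a i)" if "1 \<le> i" for i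
    using alm_minimizer_finite[OF J(2) min[OF that]] by (metis a_def real_of_ereal.simps(1))
  have opt: "a i + p i \<bullet> (K w - K (u i)) \<le> b" if "1 \<le> i" "J w = ereal b" for i w b
    using alm_optimality[OF K J(1) min[OF that(1)] a[OF that(1)] that(2)] p[OF that(1)]
    by (simp add: r_def)
  \<comment> \<open>By the affine minorant of \<open>J\<close>, an upper bound for the same dual
    functional at \<open>q\<close>; the inner product accounts for replacing \<open>g\<close> by
    \<open>gd\<close>.\<close>
  define d where "d = \<epsilon> - j - q \<bullet> (gd - g)"
  have energy: "2 * ?t * (D n - d) + (norm (q - p n))\<^sup>2 + ?t\<^sup>2 * c\<^sup>2 \<le> (norm (q - p 0))\<^sup>2"
  proof (rule proximal_point_energy[where r = r])
    show "p (Suc i) = p i + \<tau> (Suc i) *\<^sub>R r (Suc i)" for i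
      using p[of "Suc i"] by simp
    show "D (Suc i) + \<tau> (Suc i) * (norm (r (Suc i)))\<^sup>2 \<le> D i" if "i \<ge> 1" for i
    proof -
      have "a i + p i \<bullet> (K (u (Suc i)) - K (u i)) \<le> a (Suc i)"
        using opt[OF that a] by simp
      moreover have "p (Suc i) \<bullet> (K (u (Suc i)) - gd)
          = p i \<bullet> (K (u (Suc i)) - gd) - \<tau> (Suc i) * (norm (r (Suc i)))\<^sup>2"
      proof -
        have "K (u (Suc i)) - gd = - r (Suc i)" by (simp add: r_def)
        then show ?thesis
          using p[of "Suc i"] by (simp add: power2_norm_eq_inner inner_add_left)
      qed
      ultimately show ?thesis
        by (simp add: D_def inner_diff_right)
    qed
    show "D i - (q - p i) \<bullet> r i \<le> d" if "i \<ge> 1" for i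
      using q[of "u i"] a[OF that] by (simp add: D_def d_def r_def inner_simps algebra_simps)
    show "c \<le> norm (r i)" if "1 \<le> i" "i \<le> n" for i
      using c(2)[OF that] by (simp add: r_def norm_minus_commute)
  qed (use pos c in auto)
  \<comment> \<open>Testing optimality at \<open>v\<close> shows that \<open>D n - d\<close> can be
    negative only through \<open>\<epsilon>\<close> and the noise.\<close>
  have "a n + p n \<bullet> (g - K (u n)) \<le> j"
    using opt[OF n v(2)] v(1) by simp
  then have gap: "(q - p n) \<bullet> (gd - g) - \<epsilon> \<le> D n - d"
    by (simp add: D_def d_def inner_simps algebra_simps)
  have t: "0 \<le> ?t" by (rule tsum_nonneg[OF pos])
  have "0 \<le> (norm ((q - p n) + ?t *\<^sub>R (gd - g)))\<^sup>2" by simp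
  also have "\<dots> = (norm (q - p n))\<^sup>2 + 2 * ?t * ((q - p n) \<bullet> (gd - g)) + ?t\<^sup>2 * (norm (gd - g))\<^sup>2"
    by (simp only: power2_norm_eq_inner inner_add_left inner_add_right inner_scaleR_left
        inner_scaleR_right inner_commute[of "gd - g" "q - p n"])
      (simp add: algebra_simps power2_eq_square)
  also have "\<dots> \<le> (norm (q - p n))\<^sup>2 + 2 * ?t * ((q - p n) \<bullet> (gd - g)) + ?t\<^sup>2 * \<delta>\<^sup>2"
    using noise by (intro add_left_mono mult_left_mono power_mono) auto
  finally have "- (norm (q - p n))\<^sup>2 - ?t\<^sup>2 * \<delta>\<^sup>2 \<le> 2 * ?t * ((q - p n) \<bullet> (gd - g))"
    by simp
  moreover have "2 * ?t * ((q - p n) \<bullet> (gd - g) - \<epsilon>) \<le> 2 * ?t * (D n - d)"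
    using gap t by (intro mult_left_mono) auto
  moreover have "p 0 = p0" using alm by (simp add: alm_iterates_def)
  ultimately show ?thesis
    using energy by (simp add: algebra_simps)
qed

section \<open>Asymptotics at the stopping index\<close>

theorem lemma4p5:
  fixes K :: "'a::{real_inner, complete_space} \<Rightarrow> 'b::{real_inner, complete_space}"
    and J :: "'a \<Rightarrow> ereal"
    and \<tau> :: "nat \<Rightarrow> real"
    and g p0 :: 'b
    and \<rho> :: real
    and \<delta> :: "nat \<Rightarrow> real"
    and gs :: "nat \<Rightarrow> 'b"
    and u :: "nat \<Rightarrow> nat \<Rightarrow> 'a"
    and p :: "nat \<Rightarrow> nat \<Rightarrow> 'b"
  assumes "separable_space (euclidean :: 'a topology)"
    and "separable_space (euclidean :: 'b topology)"
    and "bounded_linear K"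
    and "convex_ereal J" and "lower_semicontinuous J" and "proper_fun J"
    and "\<And>(c::real) x. (\<And>n::nat. ereal ((norm (K (x n)))\<^sup>2) + J (x n) \<le> ereal c) \<Longrightarrow>
           \<exists>r l. strict_mono r \<and> weakly_converges (x \<circ> r) l"
    and "\<exists>v. J v < \<infinity> \<and> K v = g"
    and "\<And>n. n \<ge> 1 \<Longrightarrow> \<tau> n > 0"
    and "filterlim (tsum \<tau>) at_top sequentially"
    and "bdd_above (\<tau> ` {1..})"
    and "\<rho> > 1"
    and "\<And>k. \<delta> k > 0" and "\<delta> \<longlonglongrightarrow> 0"
    and "\<And>k. norm (gs k - g) \<le> \<delta> k"
    and "\<And>k. alm_iterates K J \<tau> p0 (gs k) (u k) (p k)"
    and "filterlim (\<lambda>k. morozov K \<rho> (u k) (\<delta> k) (gs k)) at_top sequentially"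
  shows "(\<lambda>k. (\<delta> k)\<^sup>2 * tsum \<tau> (morozov K \<rho> (u k) (\<delta> k) (gs k))) \<longlonglongrightarrow> 0 \<and>
         filterlim (\<lambda>k. tsum \<tau> (morozov K \<rho> (u k) (\<delta> k) (gs k))) at_top sequentially"
proof -
  let ?\<Gamma> = "\<lambda>k. morozov K \<rho> (u k) (\<delta> k) (gs k)"
  note pos = assms(9)
  have t_lim: "filterlim (\<lambda>k. tsum \<tau> (?\<Gamma> k)) at_top sequentially"
    by (rule filterlim_compose[OF assms(10,17)])
  obtain T where T: "\<And>n. n \<ge> 1 \<Longrightarrow> \<tau> n \<le> T"
    using assms(11) by (auto simp: bdd_above_def)
  \<comment> \<open>The last index before stopping: the residuals from \<open>1\<close> to
    \<open>N k\<close> all fail the discrepancy test.\<close>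
  define N where "N k = ?\<Gamma> k - 1" for k
  have N_lim: "filterlim N at_top sequentially"
    unfolding N_def by (rule filterlim_compose[OF filterlim_minus_const_nat_at_top assms(17)])
  have tN_lim: "filterlim (\<lambda>k. tsum \<tau> (N k)) at_top sequentially"
    by (rule filterlim_compose[OF assms(10) N_lim])
  have \<rho>: "0 < \<rho>\<^sup>2 - 1" using assms(12) by (simp add: one_less_power)
  have "(\<lambda>k. (\<delta> k)\<^sup>2 * tsum \<tau> (N k)) \<longlonglongrightarrow> 0"
  proof (rule order_tendstoI)
    fix e :: real assume "e < 0"
    then show "\<forall>\<^sub>F k in sequentially. e < (\<delta> k)\<^sup>2 * tsum \<tau> (N k)"
      by (intro always_eventually allI less_le_trans[OF _ mult_nonneg_nonneg])
        (auto intro: tsum_nonneg[OF pos])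
  next
    fix e :: real assume "0 < e"
    \<comment> \<open>Chosen so that \<open>4 * \<epsilon> = (\<rho>\<^sup>2 - 1) * e\<close>: half
      covers the gap term, half the initial distance once \<open>tsum \<tau> (N k)\<close> is
      large.\<close>
    define \<epsilon> where "\<epsilon> = (\<rho>\<^sup>2 - 1) * e / 4"
    have "0 < \<epsilon>" using \<rho> \<open>0 < e\<close> by (simp add: \<epsilon>_def)
    \<comment> \<open>The multiplier depends on \<open>e\<close> and the exact data but not on
      \<open>k\<close>, so \<open>norm (q - p0)\<close> stays fixed as \<open>k\<close>
      grows.\<close>
    obtain v q j where v: "K v = g" "J v = ereal j"
        and q: "\<And>w. J w \<ge> ereal (j - \<epsilon> + q \<bullet> (K w - g))"
    proof (rule approximate_multiplier[OF assms(3-6) _ assms(8) \<open>0 < \<epsilon>\<close>])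
      fix c :: real and x :: "nat \<Rightarrow> 'a"
      assume "\<And>n. ereal ((norm (K (x n)))\<^sup>2) + J (x n) \<le> ereal c"
      then show "\<exists>r l. strict_mono r \<and> weakly_converges (x \<circ> r) l"
        by (rule assms(7))
    qed blast
    have "\<forall>\<^sub>F k in sequentially. (norm (q - p0))\<^sup>2 / (2 * \<epsilon>) < tsum \<tau> (N k)"
      using tN_lim by (simp add: filterlim_at_top_dense)
    moreover have "\<forall>\<^sub>F k in sequentially. 1 \<le> N k"
      using N_lim by (simp add: filterlim_at_top)
    ultimately show "\<forall>\<^sub>F k in sequentially. (\<delta> k)\<^sup>2 * tsum \<tau> (N k) < e"
    proof eventually_elim
      case (elim k)
      let ?t = "tsum \<tau> (N k)"
      have residual: "\<rho> * \<delta> k \<le> norm (K (u k i) - gs k)" if "1 \<le> i" "i \<le> N k" for i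
      proof -
        have "i < ?\<Gamma> k" using that elim(2) by (simp add: N_def)
        then show ?thesis
          using not_less_Least[of i "\<lambda>n. n \<ge> 1 \<and> norm (K (u k n) - gs k) < \<rho> * \<delta> k"] that(1)
          by (simp add: morozov_def not_less)
      qed
      have "0 \<le> \<rho> * \<delta> k"
        using assms(12) assms(13)[of k] by simp
      from alm_residual_bound[OF bounded_linear.linear[OF assms(3)] assms(4,6) pos assms(16) v q
          assms(15) this residual elim(2)]
      have "((\<rho> * \<delta> k)\<^sup>2 - (\<delta> k)\<^sup>2) * ?t\<^sup>2 \<le> (norm (q - p0))\<^sup>2 + 2 * \<epsilon> * ?t" .
      also have "\<dots> < 4 * \<epsilon> * ?t"
        using elim(1) \<open>0 < \<epsilon>\<close> by (simp add: field_simps)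
      also have "\<dots> = (\<rho>\<^sup>2 - 1) * ?t * e"
        by (simp add: \<epsilon>_def)
      finally have "(\<rho>\<^sup>2 - 1) * ?t * ((\<delta> k)\<^sup>2 * ?t) < (\<rho>\<^sup>2 - 1) * ?t * e"
        by (simp add: algebra_simps power2_eq_square)
      moreover have "0 < ?t"
        using elim(1) \<open>0 < \<epsilon>\<close> by (auto intro: le_less_trans[rotated])
      ultimately show ?case
        using \<rho> by simp
    qed
  qed
  \<comment> \<open>The step bound \<open>T\<close> pays for the one step from \<open>N k\<close> to
    \<open>?\<Gamma> k\<close>, where the residual has no lower bound.\<close>
  then have upper: "(\<lambda>k. (\<delta> k)\<^sup>2 * tsum \<tau> (N k) + (\<delta> k)\<^sup>2 * T) \<longlonglongrightarrow> 0"
    using tendsto_add[OF _ tendsto_mult_right[OF tendsto_power[OF assms(14), of 2]]] by fastforce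
  have "(\<lambda>k. (\<delta> k)\<^sup>2 * tsum \<tau> (?\<Gamma> k)) \<longlonglongrightarrow> 0"
  proof (rule real_tendsto_sandwich[OF _ _ tendsto_const upper])
    show "\<forall>\<^sub>F k in sequentially. 0 \<le> (\<delta> k)\<^sup>2 * tsum \<tau> (?\<Gamma> k)"
      by (auto intro!: always_eventually mult_nonneg_nonneg tsum_nonneg[OF pos])
    \<comment> \<open>This excludes truncated subtraction in \<open>N k\<close>.\<close>
    have "\<forall>\<^sub>F k in sequentially. 1 \<le> ?\<Gamma> k"
      using assms(17) by (simp add: filterlim_at_top)
    then show "\<forall>\<^sub>F k in sequentially.
        (\<delta> k)\<^sup>2 * tsum \<tau> (?\<Gamma> k) \<le> (\<delta> k)\<^sup>2 * tsum \<tau> (N k) + (\<delta> k)\<^sup>2 * T"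
    proof eventually_elim
      case (elim k)
      then have "?\<Gamma> k = Suc (N k)" by (simp add: N_def)
      then have "tsum \<tau> (?\<Gamma> k) \<le> tsum \<tau> (N k) + T" using T by simp
      then have "(\<delta> k)\<^sup>2 * tsum \<tau> (?\<Gamma> k) \<le> (\<delta> k)\<^sup>2 * (tsum \<tau> (N k) + T)"
        by (rule mult_left_mono) simp
      then show ?case by (simp add: distrib_left)
    qed
  qed
  with t_lim show ?thesis by blast
qed

end
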